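(* Let $J\subset I\subsetneq R$ be ideals of a Noetherian ring $R$. Any minimal prime $\wp$ of $\mathcal{A}_{R\twoheadrightarrow R/J}(I/J)$ on $\mathcal{R}_R(I)$ is either of the form $\wp=\tilde p$ for some minimal prime $p$ of $R/J$ on $R$, or else has the form $\wp=(q,\wp_+)$, where $q:=\wp\cap R$ contains a minimal prime of $R/I$ on $R$ and $\wp_+=\wp\cap(Iu)$.
   Context: Rings are commutative with $1$. $\mathcal{S}$ denotes the symmetric algebra and $\mathcal{R}_R(I)=R[Iu]=\bigoplus_{t\ge 0}I^tu^t\subset R[u]$ ($u$ a variable) the Rees algebra; $(Iu)$ is the ideal $\mathcal{R}_R(I)_+$ of elements of positive degree. For ideals $J\subset I\subset R$, the ($R$-embedded) Aluffi algebra of $I/J$ is $$\mathcal{A}_{R\twoheadrightarrow R/J}(I/J):=\mathcal{S}_{R/J}(I/J)\otimes_{\mathcal{S}_R(I)}\mathcal{R}_R(I)\simeq \mathcal{R}_R(I)/(J,\widetilde J)\mathcal{R}_R(I)\simeq\bigoplus_{t\ge0}I^t/JI^{t-1}$$ (degree-zero part $R/J$), where $J$ is placed in degree $0$ and $\widetilde J=Ju$ in degree $1$. Minimal primes of a quotient ring $B/\mathfrak b$ "on $B$" are the primes of $B$ minimal over $\mathfrak b$; thus a minimal prime of the Aluffi algebra on $\mathcal{R}_R(I)$ is a prime minimal over $(J,\widetilde J)\mathcal{R}_R(I)$. For an ideal $\mathfrak a\subset R$, $\tilde{\mathfrak a}:=\mathfrak aR[u]\cap R[Iu]=\sum_{t\ge0}(\mathfrak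 a\cap I^t)u^t$. *)

theory Defs
  imports "HOL-Algebra.Algebra"
begin

text \<open>
  The Rees algebra \<open>R[Iu]\<close> as a subring of the polynomial ring \<open>R[u]\<close>, here \<^const>\<open>UP\<close>.
  The power \<open>I\<^sup>t\<close> is taken in the semiring of ideals of \<open>R\<close>, so \<open>I\<^sup>0 = R\<close>.
\<close>

definition rees_algebra :: "('a, 'm) ring_scheme \<Rightarrow> 'a set \<Rightarrow> ('a, nat \<Rightarrow> 'a) up_ring" where
  "rees_algebra R I =
    (UP R)\<lparr>carrier := {f \<in> carrier (UP R).
              \<forall>t::nat. coeff (UP R) f t \<in> I [^]\<^bsub>ideals_set R\<^esub> t}\<rparr>"

definition rees_irrelevant :: "('a, 'm) ring_scheme \<Rightarrow> 'a set \<Rightarrow> (nat \<Rightarrow> 'a) set" where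
  "rees_irrelevant R I = {f \<in> carrier (rees_algebra R I). coeff (UP R) f 0 = \<zero>\<^bsub>R\<^esub>}"

text \<open>For \<open>A \<subseteq> R\<close>, the set \<open>{a u\<^sup>t | a \<in> A}\<close>; for \<open>t = 0\<close> it is the copy of \<open>A\<close> in \<open>R[u]\<close>.\<close>

definition in_degree :: "('a, 'm) ring_scheme \<Rightarrow> nat \<Rightarrow> 'a set \<Rightarrow> (nat \<Rightarrow> 'a) set" where
  "in_degree R t A = (\<lambda>a. monom (UP R) a t) ` A"

text \<open>The ideal \<open>\<aa>R[u] \<inter> R[Iu]\<close>.\<close>

definition rees_tilde :: "('a, 'm) ring_scheme \<Rightarrow> 'a set \<Rightarrow> 'a set \<Rightarrow> (nat \<Rightarrow> 'a) set" where
  "rees_tilde R I \<aa> = genideal (UP R) (in_degree R 0 \<aa>) \<inter> carrier (rees_algebra R I)"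

text \<open>The contraction to \<open>R\<close> of a set of polynomials, \<open>R\<close> being the constants.\<close>

definition rees_contract :: "('a, 'm) ring_scheme \<Rightarrow> (nat \<Rightarrow> 'a) set \<Rightarrow> 'a set" where
  "rees_contract R \<PP> = {a \<in> carrier R. monom (UP R) a 0 \<in> \<PP>}"

text \<open>
  The embedded Aluffi algebra of \<open>I/J\<close> in its presentation
  \<open>\<R>\<^sub>R(I) / (J, Ju)\<R>\<^sub>R(I)\<close>, which is canonically isomorphic to the tensor product
  of the symmetric algebra of \<open>I/J\<close> over \<open>R/J\<close> with \<open>\<R>\<^sub>R(I)\<close> over the symmetric algebra of \<open>I\<close>.
\<close>

definition aluffi_ideal :: "('a, 'm) ring_scheme \<Rightarrow> 'a set \<Rightarrow> 'a set \<Rightarrow> (nat \<Rightarrow> 'a) set" where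
  "aluffi_ideal R I J = genideal (rees_algebra R I) (in_degree R 0 J \<union> in_degree R 1 J)"

definition aluffi_algebra :: "('a, 'm) ring_scheme \<Rightarrow> 'a set \<Rightarrow> 'a set \<Rightarrow> (nat \<Rightarrow> 'a) set ring" where
  "aluffi_algebra R I J = rees_algebra R I Quot aluffi_ideal R I J"

text \<open>\<open>P\<close> is a minimal prime, on the ring \<open>B\<close>, of the quotient \<open>B/\<bb>\<close>.\<close>

definition minimal_prime_over :: "('a, 'm) ring_scheme \<Rightarrow> 'a set \<Rightarrow> 'a set \<Rightarrow> bool" where
  "minimal_prime_over B \<bb> P \<longleftrightarrow>
    primeideal P B \<and> \<bb> \<subseteq> P \<and> (\<forall>Q. primeideal Q B \<and> \<bb> \<subseteq> Q \<and> Q \<subseteq> P \<longrightarrow> Q = P)"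

end

theory Submission
  imports Defs
begin

text \<open>
  Let \<open>q = \<PP> \<inter> R\<close>. If \<open>I \<subseteq> q\<close>, then \<open>q\<close> contains a minimal prime of \<open>I\<close>, and \<open>\<PP>\<close> is
  generated by \<open>q\<close> and \<open>\<PP>\<^sub>+\<close> because it is homogeneous: its largest homogeneous subideal is
  prime and still contains \<open>J\<close> and \<open>J u\<close>. Otherwise choose \<open>a \<in> I - q\<close>. For \<open>c \<in> q \<inter> I\<^sup>t\<close>,
  \<open>a\<^sup>t (c u\<^sup>t) = c (a u)\<^sup>t \<in> \<PP>\<close> forces \<open>c u\<^sup>t \<in> \<PP>\<close>, so the prime \<open>q R[u] \<inter> R[Iu]\<close> lies in \<open>\<PP>\<close>;
  as it contains \<open>J\<close> and \<open>J u\<close>, it equals \<open>\<PP>\<close> by minimality.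
\<close>

section \<open>Ideals and prime ideals of a commutative ring\<close>

lemma (in additive_subgroup) finsum_mem:
  assumes "abelian_monoid G" "finite K" "\<And>k. k \<in> K \<Longrightarrow> h k \<in> H"
  shows "finsum G h K \<in> H"
proof -
  interpret abelian_monoid G by fact
  show ?thesis
    using assms(2,3)
  proof (induction K rule: finite_induct)
    case (insert x K)
    then have "h \<in> K \<rightarrow> carrier G" "h x \<in> carrier G"
      using a_Hcarr by auto
    then show ?case
      using insert by simp
  qed simp
qed

text \<open>Closure under negation follows from multiplication by -1, and the other side of
  absorption from commutativity, so neither has to be checked in applications.\<close>

lemma (in cring) idealI_cring:
  assumes "S \<subseteq> carrier R" "\<zero> \<in> S"
    and add: "\<And>x y. x \<in> S \<Longrightarrow> y \<in> S \<Longrightarrow> x \<oplus> y \<in> S"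
    and mult: "\<And>a x. a \<in> S \<Longrightarrow> x \<in> carrier R \<Longrightarrow> x \<otimes> a \<in> S"
  shows "ideal S R"
proof (rule idealI)
  have "\<ominus> x \<in> S" if "x \<in> S" for x
    using mult[OF that, of "\<ominus> \<one>"] that assms(1) by (auto simp: l_minus)
  then show "subgroup S (add_monoid R)"
    using assms by (intro add.subgroupI) (auto simp: a_inv_def)
next
  fix a x assume "a \<in> S" "x \<in> carrier R"
  then show "a \<otimes> x \<in> S"
    using mult[of a x] assms(1) m_comm[of a x] by auto
qed (use mult ring_axioms in auto)

lemma (in primeideal) prime_pow:
  assumes "a \<in> carrier R" "a [^] (n::nat) \<in> I"
  shows "a \<in> I"
  using assms(2)
proof (induction n)
  case 0
  then show ?case
    using one_imp_carrier I_notcarr by simp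
next
  case (Suc n)
  then show ?case
    using I_prime[of "a [^] n" a] assms(1) by auto
qed

text \<open>If \<open>a\<close> avoids \<open>p\<close> and \<open>b\<close> avoids
  \<open>p'\<close>, then both avoid the smaller of these two members of the chain, which is
  \<open>p \<inter> p'\<close>. That prime contains \<open>a \<otimes> b\<close>, a
  contradiction.\<close>

lemma (in cring) primeideal_Inter_chain:
  assumes ne: "S \<noteq> {}"
    and prime: "\<And>p. p \<in> S \<Longrightarrow> primeideal p R"
    and chain: "\<And>p p'. p \<in> S \<Longrightarrow> p' \<in> S \<Longrightarrow> p \<subseteq> p' \<or> p' \<subseteq> p"
  shows "primeideal (\<Inter>S) R"
proof (rule primeidealI)
  have ideals: "ideal p R" if "p \<in> S" for p
    using prime[OF that] by (simp add: primeideal_def)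
  show "ideal (\<Inter>S) R"
    using i_Intersect[of S] ideals ne by blast
  show "carrier R \<noteq> \<Inter>S"
  proof
    assume "carrier R = \<Inter>S"
    moreover obtain p where "p \<in> S"
      using ne by blast
    ultimately show False
      using ideals[of p] prime[of p] primeideal.I_notcarr[of p R] ideal.Icarr[of p R] by blast
  qed
  fix a b assume ab: "a \<in> carrier R" "b \<in> carrier R" "a \<otimes> b \<in> \<Inter>S"
  show "a \<in> \<Inter>S \<or> b \<in> \<Inter>S"
  proof (rule ccontr)
    assume "\<not> ?thesis"
    then obtain p p' where "p \<in> S" "a \<notin> p" "p' \<in> S" "b \<notin> p'"
      by blast
    moreover from this have "p \<inter> p' \<in> S"
      using chain[of p p'] by (auto simp: Int_absorb1 Int_absorb2)
    ultimately show False
      using primeideal.I_prime[OF prime ab(1,2), of "p \<inter> p'"] ab(3) by blast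
  qed
qed (rule is_cring)

text \<open>Zorn's lemma for the primes between \<open>\<bb>\<close> and \<open>q\<close>, ordered
  by reverse inclusion; the upper bound of a chain is its intersection.\<close>

lemma (in cring) minimal_prime_below:
  assumes q: "primeideal q R" and "\<bb> \<subseteq> q"
  shows "\<exists>p. minimal_prime_over R \<bb> p \<and> p \<subseteq> q"
proof -
  define S where "S = {p. primeideal p R \<and> \<bb> \<subseteq> p \<and> p \<subseteq> q}"
  have "q \<in> S"
    using assms by (simp add: S_def)
  \<comment> \<open>Passing to complements turns minimal elements into maximal ones and
    intersections of chains into unions, the form in which Zorn's lemma is stated.\<close>
  have "\<exists>M\<in>uminus ` S. \<forall>p\<in>uminus ` S. M \<subseteq> p \<longrightarrow> p = M"
  proof (rule subset_Zorn_nonempty)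
    show "uminus ` S \<noteq> {}"
      using \<open>q \<in> S\<close> by blast
    fix C assume "C \<noteq> {}" and C: "subset.chain (uminus ` S) C"
    define T where "T = uminus ` C"
    have T: "T \<noteq> {}" "T \<subseteq> S" "\<Union>C = - \<Inter>T"
      using \<open>C \<noteq> {}\<close> C by (auto simp: T_def subset.chain_def)
    have "primeideal (\<Inter>T) R"
    proof (rule primeideal_Inter_chain[OF T(1)])
      show "primeideal p R" if "p \<in> T" for p
        using that T(2) by (auto simp: S_def)
      show "p \<subseteq> p' \<or> p' \<subseteq> p" if "p \<in> T" "p' \<in> T" for p p'
        using that C unfolding T_def subset.chain_def by blast
    qed
    moreover have "\<bb> \<subseteq> \<Inter>T" "\<Inter>T \<subseteq> q"
      using T(1,2) by (auto simp: S_def)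
    ultimately show "\<Union>C \<in> uminus ` S"
      using T(3) by (simp add: S_def)
  qed
  then obtain p where p: "p \<in> S" "\<And>p'. p' \<in> S \<Longrightarrow> p' \<subseteq> p \<Longrightarrow> p' = p"
    by (auto simp: image_iff)
  then show ?thesis
    unfolding minimal_prime_over_def S_def by blast
qed

section \<open>Extension of ideals to the polynomial ring\<close>

context UP_cring
begin

text \<open>The right-hand side is an ideal containing the constants from \<open>\<aa>\<close>.
  Conversely, each term of such an \<open>f\<close> is a constant from \<open>\<aa>\<close> times a
  power of the variable, and \<open>f\<close> is the finite sum of its terms.\<close>

lemma genideal_constants:
  assumes "ideal \<aa> R"
  shows "genideal P (in_degree R 0 \<aa>) = {f \<in> carrier P. \<forall>t. up_ring.coeff P f t \<in> \<aa>}"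
proof
  interpret \<aa>: ideal \<aa> R by fact
  have gens: "in_degree R 0 \<aa> \<subseteq> carrier P"
    by (auto simp: in_degree_def P_def[symmetric])
  let ?S = "{f \<in> carrier P. \<forall>t. up_ring.coeff P f t \<in> \<aa>}"
  have "ideal ?S P"
    by (rule P.idealI_cring)
      (auto intro!: \<aa>.finsum_mem R.abelian_monoid_axioms \<aa>.I_l_closed)
  then show "genideal P (in_degree R 0 \<aa>) \<subseteq> ?S"
    by (rule P.genideal_minimal) (auto simp: in_degree_def P_def[symmetric])
  interpret G: ideal "genideal P (in_degree R 0 \<aa>)" P
    using gens by (rule P.genideal_ideal)
  show "?S \<subseteq> genideal P (in_degree R 0 \<aa>)"
  proof
    fix f assume f: "f \<in> ?S"
    have "up_ring.monom P (up_ring.coeff P f t) t \<in> genideal P (in_degree R 0 \<aa>)" for t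
    proof -
      have "up_ring.monom P (up_ring.coeff P f t) 0 \<in> genideal P (in_degree R 0 \<aa>)"
        using P.genideal_self[OF gens] f by (auto simp: in_degree_def P_def[symmetric])
      then have "up_ring.monom P (up_ring.coeff P f t) 0 \<otimes>\<^bsub>P\<^esub> up_ring.monom P \<one> t
          \<in> genideal P (in_degree R 0 \<aa>)"
        by (rule G.I_r_closed) simp
      then show ?thesis
        using f by (simp flip: monom_mult)
    qed
    then have "(\<Oplus>\<^bsub>P\<^esub> i \<in> {..deg R f}. up_ring.monom P (up_ring.coeff P f i) i)
        \<in> genideal P (in_degree R 0 \<aa>)"
      by (intro G.finsum_mem P.abelian_monoid_axioms) auto
    then show "f \<in> genideal P (in_degree R 0 \<aa>)"
      using f by (simp add: up_repr)
  qed
qed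

end

section \<open>The Rees algebra as a graded subring of the polynomial ring\<close>

locale rees_ring = UP_cring +
  fixes I
  assumes I_ideal: "ideal I R"
begin

definition power_I :: "nat \<Rightarrow> 'a set"
  where "power_I t = I [^]\<^bsub>ideals_set R\<^esub> t"

abbreviation Rees
  where "Rees \<equiv> rees_algebra R I"

text \<open>For additive subgroups \<open>A t\<close> this is the homogeneous subgroup with
  component \<open>A t\<close> in degree \<open>t\<close>. The Rees algebra, the ideals
  \<open>rees_tilde\<close> and the homogeneous part of a prime all arise in this way.\<close>

definition graded_set :: "(nat \<Rightarrow> 'a set) \<Rightarrow> (nat \<Rightarrow> 'a) set"
  where "graded_set A = {f \<in> carrier P. \<forall>t. up_ring.coeff P f t \<in> A t}"

lemma ideal_power_I: "ideal (power_I t) R"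
proof -
  interpret ISet: comm_monoid "ideals_set R"
    by (rule R.ideals_set_is_comm_monoid)
  show ?thesis
    using ISet.nat_pow_closed[of I t] I_ideal by (simp add: power_I_def ideals_set_def)
qed

lemma power_I_0 [simp]: "power_I 0 = carrier R"
  by (simp add: power_I_def ideals_set_def)

lemma power_I_1 [simp]: "power_I (Suc 0) = I"
proof -
  interpret ISet: comm_monoid "ideals_set R"
    by (rule R.ideals_set_is_comm_monoid)
  show ?thesis
    using ISet.nat_pow_eone[of I] I_ideal by (simp add: power_I_def ideals_set_def)
qed

lemma power_I_closed: "a \<in> power_I t \<Longrightarrow> a \<in> carrier R"
  using ideal.Icarr[OF ideal_power_I] .

lemma power_I_mult:
  assumes "a \<in> power_I s" "b \<in> power_I t"
  shows "a \<otimes> b \<in> power_I (s + t)"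
proof -
  interpret ISet: comm_monoid "ideals_set R"
    by (rule R.ideals_set_is_comm_monoid)
  have "power_I (s + t) = ideal_prod R (power_I s) (power_I t)"
    using ISet.nat_pow_mult[of I s t] I_ideal by (simp add: power_I_def ideals_set_def)
  then show ?thesis
    using assms by (simp add: ideal_prod.prod)
qed

lemma power_I_pow: "a \<in> I \<Longrightarrow> a [^] t \<in> power_I t"
proof (induction t)
  case (Suc t)
  then show ?case
    using power_I_mult[of "a [^] t" t a 1] by simp
qed simp

lemma carrier_Rees: "carrier Rees = graded_set power_I"
  by (simp add: rees_algebra_def graded_set_def power_I_def P_def)

lemma Rees_simps [simp]:
  "(\<otimes>\<^bsub>Rees\<^esub>) = (\<otimes>\<^bsub>P\<^esub>)" "(\<oplus>\<^bsub>Rees\<^esub>) = (\<oplus>\<^bsub>P\<^esub>)" "\<one>\<^bsub>Rees\<^esub> = \<one>\<^bsub>P\<^esub>" "\<zero>\<^bsub>Rees\<^esub> = \<zero>\<^bsub>P\<^esub>"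
  by (simp_all add: rees_algebra_def P_def)

lemma Rees_closed: "f \<in> carrier Rees \<Longrightarrow> f \<in> carrier P"
  by (simp add: carrier_Rees graded_set_def)

lemma coeff_Rees: "f \<in> carrier Rees \<Longrightarrow> up_ring.coeff P f t \<in> power_I t"
  by (simp add: carrier_Rees graded_set_def)

lemma monom_graded_set:
  assumes "\<And>t. additive_subgroup (A t) R"
  shows "a \<in> A t \<Longrightarrow> up_ring.monom P a t \<in> graded_set A"
  using additive_subgroup.a_Hcarr[OF assms] additive_subgroup.zero_closed[OF assms]
  by (auto simp: graded_set_def)

lemma monom_Rees: "a \<in> power_I t \<Longrightarrow> up_ring.monom P a t \<in> carrier Rees"
  unfolding carrier_Rees by (rule monom_graded_set) (rule ideal.axioms(1)[OF ideal_power_I])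

lemma graded_set_add:
  assumes "\<And>t. additive_subgroup (A t) R" "f \<in> graded_set A" "g \<in> graded_set A"
  shows "f \<oplus>\<^bsub>P\<^esub> g \<in> graded_set A"
  using assms(2,3) additive_subgroup.a_closed[OF assms(1)] by (simp add: graded_set_def)

text \<open>Each coefficient of the product is a convolution sum whose terms all lie in
  \<open>A n\<close>. Three separate families allow one statement to serve both for the product of
  the Rees algebra and for absorption by a homogeneous ideal.\<close>

lemma graded_set_mult:
  assumes "\<And>t. additive_subgroup (A t) R"
    and mult: "\<And>s t a b. a \<in> B s \<Longrightarrow> b \<in> C t \<Longrightarrow> a \<otimes> b \<in> A (s + t)"
    and "f \<in> graded_set B" "g \<in> graded_set C"
  shows "f \<otimes>\<^bsub>P\<^esub> g \<in> graded_set A"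
proof -
  have "(\<Oplus>i\<in>{..n}. up_ring.coeff P f i \<otimes> up_ring.coeff P g (n - i)) \<in> A n" for n
  proof (rule additive_subgroup.finsum_mem[OF assms(1) R.abelian_monoid_axioms])
    fix k assume "k \<in> {..n}"
    then show "up_ring.coeff P f k \<otimes> up_ring.coeff P g (n - k) \<in> A n"
      using mult[of "up_ring.coeff P f k" k "up_ring.coeff P g (n - k)" "n - k"] assms(3,4)
      by (simp add: graded_set_def)
  qed simp
  then show ?thesis
    using assms(3,4) by (simp add: graded_set_def)
qed

lemma Rees_cring: "cring Rees"
proof -
  note sub = ideal.axioms(1)[OF ideal_power_I]
  have "subring (graded_set power_I) P"
  proof (rule P.subringI)
    show "graded_set power_I \<subseteq> carrier P"
      by (auto simp: graded_set_def)
    show "\<one>\<^bsub>P\<^esub> \<in> graded_set power_I"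
      using additive_subgroup.zero_closed[OF sub] by (simp add: graded_set_def)
    show "\<ominus>\<^bsub>P\<^esub> h \<in> graded_set power_I" if "h \<in> graded_set power_I" for h
      using that additive_subgroup.a_inv_closed[OF sub] by (simp add: graded_set_def)
    show "f \<otimes>\<^bsub>P\<^esub> g \<in> graded_set power_I" "f \<oplus>\<^bsub>P\<^esub> g \<in> graded_set power_I"
      if "f \<in> graded_set power_I" "g \<in> graded_set power_I" for f g
      using graded_set_mult[where A = power_I, OF sub power_I_mult that] graded_set_add[OF sub that] by auto
  qed
  then have "cring (P\<lparr>carrier := graded_set power_I\<rparr>)"
    using P.subcring_iff P.subcringI' subringE(1) by metis
  then show ?thesis
    by (simp add: rees_algebra_def graded_set_def power_I_def P_def)
qed

end

sublocale rees_ring \<subseteq> Rees: cring Rees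
  by (rule Rees_cring)

section \<open>Homogeneous ideals of the Rees algebra and their primality\<close>

context rees_ring
begin

lemma ideal_graded_set:
  assumes sub: "\<And>t. additive_subgroup (A t) R"
    and "\<And>t. A t \<subseteq> power_I t"
    and "\<And>s t a r. r \<in> power_I s \<Longrightarrow> a \<in> A t \<Longrightarrow> r \<otimes> a \<in> A (s + t)"
  shows "ideal (graded_set A) Rees"
proof (rule Rees.idealI_cring)
  show "graded_set A \<subseteq> carrier Rees"
    using assms(2) by (auto simp: carrier_Rees graded_set_def)
  show "\<zero>\<^bsub>Rees\<^esub> \<in> graded_set A"
    using additive_subgroup.zero_closed[OF sub] by (simp add: graded_set_def)
  show "f \<oplus>\<^bsub>Rees\<^esub> g \<in> graded_set A" if "f \<in> graded_set A" "g \<in> graded_set A" for f g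
    using graded_set_add[OF sub that] by simp
  show "f \<otimes>\<^bsub>Rees\<^esub> g \<in> graded_set A" if "g \<in> graded_set A" "f \<in> carrier Rees" for f g
    using graded_set_mult[where A = A and B = power_I and C = A, OF sub assms(3)] that by (simp add: carrier_Rees)
qed

text \<open>
  If neither \<open>f\<close> nor \<open>g\<close> lies in the graded ideal, compare the coefficients of \<open>f \<otimes> g\<close> at
  the sum of the lowest degrees in which \<open>f\<close> and \<open>g\<close> leave it.
\<close>

lemma primeideal_graded_set:
  assumes sub: "\<And>t. additive_subgroup (A t) R"
    and sub_power: "\<And>t. A t \<subseteq> power_I t"
    and mult: "\<And>s t a r. r \<in> power_I s \<Longrightarrow> a \<in> A t \<Longrightarrow> r \<otimes> a \<in> A (s + t)"
    and prime: "\<And>s t a b. a \<in> power_I s \<Longrightarrow> b \<in> power_I t \<Longrightarrow> a \<otimes> b \<in> A (s + t)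
      \<Longrightarrow> a \<in> A s \<or> b \<in> A t"
    and "\<one> \<notin> A 0"
  shows "primeideal (graded_set A) Rees"
proof (rule primeidealI[OF ideal_graded_set[OF sub sub_power mult] Rees_cring])
  have "\<one>\<^bsub>P\<^esub> \<notin> graded_set A"
    using \<open>\<one> \<notin> A 0\<close> by (auto simp: graded_set_def intro!: exI[of _ 0])
  then show "carrier Rees \<noteq> graded_set A"
    using Rees.one_closed by auto
  fix f g assume f: "f \<in> carrier Rees" and g: "g \<in> carrier Rees"
    and "f \<otimes>\<^bsub>Rees\<^esub> g \<in> graded_set A"
  then have fg: "up_ring.coeff P (f \<otimes>\<^bsub>P\<^esub> g) n \<in> A n" for n
    by (simp add: graded_set_def)
  note closed = Rees_closed[OF f] Rees_closed[OF g]
  show "f \<in> graded_set A \<or> g \<in> graded_set A"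
  proof (rule ccontr)
    assume "\<not> ?thesis"
    then have ex: "\<exists>i. up_ring.coeff P f i \<notin> A i" "\<exists>j. up_ring.coeff P g j \<notin> A j"
      using closed by (auto simp: graded_set_def)
    define i where "i = (LEAST i. up_ring.coeff P f i \<notin> A i)"
    define j where "j = (LEAST j. up_ring.coeff P g j \<notin> A j)"
    have i: "up_ring.coeff P f i \<notin> A i" "\<And>k. k < i \<Longrightarrow> up_ring.coeff P f k \<in> A k"
      unfolding i_def using LeastI_ex[OF ex(1)] not_less_Least by blast+
    have j: "up_ring.coeff P g j \<notin> A j" "\<And>k. k < j \<Longrightarrow> up_ring.coeff P g k \<in> A k"
      unfolding j_def using LeastI_ex[OF ex(2)] not_less_Least by blast+
    interpret A: additive_subgroup "A (i + j)" R
      by (rule sub)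
    let ?h = "\<lambda>k. up_ring.coeff P f k \<otimes> up_ring.coeff P g (i + j - k)"
    let ?rest = "finsum R ?h ({..i + j} - {i})"
    \<comment> \<open>For \<open>k < i\<close> the coefficient of \<open>f\<close> lies in
      \<open>A k\<close> by the choice of \<open>i\<close>. For \<open>k > i\<close> the index
      \<open>i + j - k\<close> is below \<open>j\<close>, so the coefficient of \<open>g\<close>
      lies in its component by the choice of \<open>j\<close>.\<close>
    have rest: "?rest \<in> A (i + j)"
    proof (rule A.finsum_mem[OF R.abelian_monoid_axioms])
      fix k assume k: "k \<in> {..i + j} - {i}"
      show "?h k \<in> A (i + j)"
      proof (cases "k < i")
        case True
        then have "up_ring.coeff P g (i + j - k) \<otimes> up_ring.coeff P f k \<in> A (i + j - k + k)"
          by (intro mult coeff_Rees g i)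
        then show ?thesis
          using k closed by (simp add: R.m_comm)
      next
        case False
        then have "?h k \<in> A (k + (i + j - k))"
          using k by (intro mult coeff_Rees f j) auto
        then show ?thesis
          using k by simp
      qed
    qed simp
    have "up_ring.coeff P (f \<otimes>\<^bsub>P\<^esub> g) (i + j) = finsum R ?h (insert i ({..i + j} - {i}))"
      using closed by (simp add: insert_absorb)
    also have "\<dots> = ?h i \<oplus> ?rest"
      using closed by (subst R.finsum_insert) auto
    finally have "up_ring.coeff P (f \<otimes>\<^bsub>P\<^esub> g) (i + j) \<ominus> ?rest = ?h i"
      using closed A.a_Hcarr[OF rest] by (simp add: R.minus_eq R.a_assoc R.r_neg)
    then have "up_ring.coeff P f i \<otimes> up_ring.coeff P g j \<in> A (i + j)"
      using A.a_closed[OF fg A.a_inv_closed[OF rest]] by (simp add: R.minus_eq)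
    then show False
      using prime[OF coeff_Rees[OF f] coeff_Rees[OF g]] i(1) j(1) by blast
  qed
qed

lemma mem_of_monoms:
  assumes "ideal Q Rees" "f \<in> carrier P" "\<And>t. up_ring.monom P (up_ring.coeff P f t) t \<in> Q"
  shows "f \<in> Q"
proof -
  interpret Q: ideal Q Rees by fact
  \<comment> \<open>The sum is formed in \<open>P\<close>, whereas \<open>Q\<close> is an additive
    subgroup of \<open>Rees\<close>; hence an induction on the bound instead of
    \<open>finsum_mem\<close>.\<close>
  have "finsum P (\<lambda>t. up_ring.monom P (up_ring.coeff P f t) t) {..n} \<in> Q" for n
  proof (induction n)
    case (Suc n)
    then show ?case
      using assms(2) Q.a_closed[OF assms(3) Suc, of "Suc n"] by simp
  qed (use assms in simp)
  then show ?thesis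
    using up_repr[OF assms(2)] by metis
qed

section \<open>Tilde ideals and contraction to the base ring\<close>

lemma rees_tilde_eq:
  assumes "ideal \<aa> R"
  shows "rees_tilde R I \<aa> = graded_set (\<lambda>t. \<aa> \<inter> power_I t)"
  using genideal_constants[OF assms] carrier_Rees
  by (auto simp: rees_tilde_def graded_set_def P_def)

text \<open>Primality can be tested on homogeneous elements: a factor that lies in \<open>q\<close>
  and in its power of \<open>I\<close> lies in the corresponding component.\<close>

lemma primeideal_rees_tilde:
  assumes "primeideal q R"
  shows "primeideal (rees_tilde R I q) Rees"
proof -
  interpret q: primeideal q R by fact
  show ?thesis
    unfolding rees_tilde_eq[OF q.is_ideal]
  proof (rule primeideal_graded_set)
    show "additive_subgroup (q \<inter> power_I t) R" for t
      using R.i_intersect[OF q.is_ideal ideal_power_I] by (rule ideal.axioms(1))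
    show "r \<otimes> a \<in> q \<inter> power_I (s + t)" if "r \<in> power_I s" "a \<in> q \<inter> power_I t" for s t a r
      using that power_I_mult q.I_l_closed power_I_closed by blast
    show "a \<in> q \<inter> power_I s \<or> b \<in> q \<inter> power_I t"
      if "a \<in> power_I s" "b \<in> power_I t" "a \<otimes> b \<in> q \<inter> power_I (s + t)" for s t a b
      using that q.I_prime power_I_closed by blast
    show "\<one> \<notin> q \<inter> power_I 0"
      using q.one_imp_carrier q.I_notcarr by auto
  qed blast
qed

text \<open>The degree 0 component of the tilde ideal is \<open>q \<inter> power_I 0\<close>, that
  is, \<open>q\<close>. Thus a prime can be recovered from its tilde ideal.\<close>

lemma rees_contract_tilde:
  assumes "ideal q R"
  shows "rees_contract R (rees_tilde R I q) = q"
proof -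
  interpret q: ideal q R by fact
  have "a \<in> carrier R \<Longrightarrow> up_ring.monom P a 0 \<in> rees_tilde R I q \<longleftrightarrow> a \<in> q" for a
    using additive_subgroup.zero_closed[OF ideal.axioms(1)[OF ideal_power_I]]
    by (auto simp: rees_tilde_eq[OF assms] graded_set_def split: if_splits)
  then show ?thesis
    unfolding rees_contract_def P_def by auto
qed

lemma primeideal_rees_contract:
  assumes "primeideal Q Rees"
  shows "primeideal (rees_contract R Q) R"
proof -
  interpret Q: primeideal Q Rees by fact
  have mem: "a \<in> rees_contract R Q \<longleftrightarrow> a \<in> carrier R \<and> up_ring.monom P a 0 \<in> Q" for a
    by (simp add: rees_contract_def P_def)
  have mult: "up_ring.monom P (a \<otimes> b) 0 = up_ring.monom P a 0 \<otimes>\<^bsub>P\<^esub> up_ring.monom P b 0"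
    if "a \<in> carrier R" "b \<in> carrier R" for a b
    using monom_mult[OF that, of 0 0] by simp
  show ?thesis
  proof (rule primeidealI[OF _ R.is_cring])
    show "ideal (rees_contract R Q) R"
    proof (rule R.idealI_cring)
      show "x \<otimes> a \<in> rees_contract R Q" if "a \<in> rees_contract R Q" "x \<in> carrier R" for a x
        using that Q.I_l_closed[of "up_ring.monom P a 0" "up_ring.monom P x 0"] by (simp add: mem mult monom_Rees)
    qed (use Q.zero_closed Q.a_closed in \<open>auto simp: mem\<close>)
    have "\<one>\<^bsub>P\<^esub> \<notin> Q"
      using Q.one_imp_carrier Q.I_notcarr by auto
    then show "carrier R \<noteq> rees_contract R Q"
      using mem[of \<one>] by auto
    show "a \<in> rees_contract R Q \<or> b \<in> rees_contract R Q"
      if "a \<in> carrier R" "b \<in> carrier R" "a \<otimes> b \<in> rees_contract R Q" for a b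
      using that Q.I_prime[of "up_ring.monom P a 0" "up_ring.monom P b 0"] by (auto simp: mem mult monom_Rees)
  qed
qed

lemma rees_tilde_contract_subset:
  assumes "primeideal Q Rees" "\<not> I \<subseteq> rees_contract R Q"
  shows "rees_tilde R I (rees_contract R Q) \<subseteq> Q"
proof
  interpret Q: primeideal Q Rees by fact
  let ?q = "rees_contract R Q"
  interpret q: primeideal ?q R
    using assms(1) by (rule primeideal_rees_contract)
  obtain a where a: "a \<in> I" "a \<notin> ?q"
    using assms(2) by blast
  have a_carr: "a \<in> carrier R"
    using a(1) ideal.Icarr[OF I_ideal] by blast
  fix f assume "f \<in> rees_tilde R I ?q"
  then have f: "f \<in> carrier P" "\<And>t. up_ring.coeff P f t \<in> ?q" "\<And>t. up_ring.coeff P f t \<in> power_I t"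
    by (auto simp: rees_tilde_eq[OF q.is_ideal] graded_set_def)
  have "up_ring.monom P (up_ring.coeff P f t) t \<in> Q" for t
  proof -
    let ?c = "up_ring.coeff P f t"
    have pow: "a [^] t \<in> carrier R"
      using a_carr by simp
    have "up_ring.monom P ?c 0 \<in> Q"
      using f(2)[of t] unfolding rees_contract_def P_def by blast
    then have "up_ring.monom P ?c 0 \<otimes>\<^bsub>P\<^esub> up_ring.monom P (a [^] t) t \<in> Q"
      using Q.I_r_closed[OF _ monom_Rees[OF power_I_pow[OF a(1)]]] unfolding Rees_simps by blast
    \<comment> \<open>The power of the variable moves from one factor to the other. Both new factors
      lie in \<open>Rees\<close>, since \<open>?c\<close> is in \<open>power_I t\<close>, so
      primality of \<open>Q\<close> applies to them.\<close>
    also have "up_ring.monom P ?c 0 \<otimes>\<^bsub>P\<^esub> up_ring.monom P (a [^] t) t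
        = up_ring.monom P (a [^] t) 0 \<otimes>\<^bsub>P\<^esub> up_ring.monom P ?c t"
    proof -
      have "?c \<in> carrier R"
        using coeff_closed[OF f(1)] .
      with pow show ?thesis
        using monom_mult[of ?c "a [^] t" 0 t] monom_mult[of "a [^] t" ?c 0 t]
          R.m_comm[of ?c "a [^] t"] by (metis add_0)
    qed
    finally have "up_ring.monom P (a [^] t) 0 \<in> Q \<or> up_ring.monom P ?c t \<in> Q"
      using Q.I_prime[of "up_ring.monom P (a [^] t) 0" "up_ring.monom P ?c t"] pow f(3) by (simp add: monom_Rees)
    moreover have "up_ring.monom P (a [^] t) 0 \<notin> Q"
      using q.prime_pow[OF a_carr, of t] a(2) pow unfolding rees_contract_def P_def by blast
    ultimately show ?thesis
      by blast
  qed
  then show "f \<in> Q"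
    using mem_of_monoms[OF Q.is_ideal f(1)] by blast
qed

section \<open>Homogeneity of minimal primes\<close>

text \<open>This is the largest homogeneous ideal inside \<open>Q\<close>. Its primality is tested
  on homogeneous elements, where it is the primality of \<open>Q\<close> applied to
  monomials.\<close>

lemma primeideal_homogeneous_part:
  assumes "primeideal Q Rees"
  shows "primeideal (graded_set (\<lambda>t. {c \<in> power_I t. up_ring.monom P c t \<in> Q})) Rees"
proof (rule primeideal_graded_set)
  interpret Q: primeideal Q Rees by fact
  fix t
  interpret It: ideal "power_I t" R
    by (rule ideal_power_I)
  \<comment> \<open>The inverse is taken in \<open>P\<close>, but \<open>Q\<close> is an ideal of
    \<open>Rees\<close>; the negative is therefore written as a multiple by the constant -1, which
    lies in \<open>Rees\<close>.\<close>
  have neg: "\<ominus>\<^bsub>P\<^esub> f \<in> Q" if "f \<in> Q" for f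
  proof -
    have "f \<in> carrier P"
      using that Q.Icarr Rees_closed by blast
    moreover have "up_ring.monom P (\<ominus> \<one>) 0 \<otimes>\<^bsub>P\<^esub> f \<in> Q"
      using that Q.I_l_closed[of f "up_ring.monom P (\<ominus> \<one>) 0"] monom_Rees[of "\<ominus> \<one>" 0] by simp
    ultimately show ?thesis
      by (simp add: P.l_minus)
  qed
  show "additive_subgroup {c \<in> power_I t. up_ring.monom P c t \<in> Q} R"
  proof (rule additive_subgroupI, rule R.add.subgroupI)
    have "\<zero> \<in> {c \<in> power_I t. up_ring.monom P c t \<in> Q}"
      using It.zero_closed Q.zero_closed by simp
    then show "{c \<in> power_I t. up_ring.monom P c t \<in> Q} \<noteq> {}"
      by blast
  qed (use It.a_closed It.a_inv_closed It.Icarr Q.a_closed neg in \<open>auto simp flip: a_inv_def\<close>)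
next
  interpret Q: primeideal Q Rees by fact
  show "r \<otimes> a \<in> {c \<in> power_I (s + t). up_ring.monom P c (s + t) \<in> Q}"
    if "r \<in> power_I s" "a \<in> {c \<in> power_I t. up_ring.monom P c t \<in> Q}" for s t a r
    using that power_I_mult power_I_closed Q.I_l_closed[of "up_ring.monom P a t" "up_ring.monom P r s"]
    by (auto simp: monom_Rees)
  show "a \<in> {c \<in> power_I s. up_ring.monom P c s \<in> Q} \<or> b \<in> {c \<in> power_I t. up_ring.monom P c t \<in> Q}"
    if "a \<in> power_I s" "b \<in> power_I t"
      "a \<otimes> b \<in> {c \<in> power_I (s + t). up_ring.monom P c (s + t) \<in> Q}" for s t a b
    using that power_I_closed Q.I_prime[of "up_ring.monom P a s" "up_ring.monom P b t"]
    by (auto simp: monom_Rees)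
  show "\<one> \<notin> {c \<in> power_I 0. up_ring.monom P c 0 \<in> Q}"
    using Q.one_imp_carrier Q.I_notcarr by auto
qed blast

text \<open>The homogeneous part \<open>H\<close> of \<open>Q\<close> is prime and contains the
  homogeneous generators in \<open>S\<close>, so minimality gives \<open>H = Q\<close>.\<close>

lemma minimal_prime_homogeneous:
  assumes min: "minimal_prime_over Rees (genideal Rees S) Q"
    and S: "\<And>f. f \<in> S \<Longrightarrow> \<exists>t. \<exists>c\<in>power_I t. f = up_ring.monom P c t"
    and "f \<in> Q"
  shows "up_ring.monom P (up_ring.coeff P f t) t \<in> Q"
proof -
  interpret Q: primeideal Q Rees
    using min by (simp add: minimal_prime_over_def)
  define H where "H = graded_set (\<lambda>t. {c \<in> power_I t. up_ring.monom P c t \<in> Q})"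
  have H: "primeideal H Rees"
    unfolding H_def using Q.primeideal by (rule primeideal_homogeneous_part)
  have "S \<subseteq> carrier Rees"
    using S monom_Rees by blast
  then have "S \<subseteq> Q"
    using Rees.genideal_self min by (auto simp: minimal_prime_over_def)
  have "f \<in> H" if f: "f \<in> S" for f
  proof -
    obtain s c where c: "c \<in> power_I s" "f = up_ring.monom P c s"
      using S[OF f] by blast
    moreover have "up_ring.monom P c s \<in> Q"
      using c f \<open>S \<subseteq> Q\<close> by blast
    ultimately show ?thesis
      using power_I_closed[OF c(1)] Q.zero_closed
        additive_subgroup.zero_closed[OF ideal.axioms(1)[OF ideal_power_I]]
      by (auto simp: H_def graded_set_def)
  qed
  then have "genideal Rees S \<subseteq> H"
    using H by (intro Rees.genideal_minimal) (auto simp: primeideal_def)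
  moreover have "H \<subseteq> Q"
    using mem_of_monoms[OF Q.is_ideal] by (auto simp: H_def graded_set_def)
  ultimately have "H = Q"
    using min H by (simp add: minimal_prime_over_def)
  then show ?thesis
    using \<open>f \<in> Q\<close> by (auto simp: H_def graded_set_def)
qed

text \<open>Each \<open>f\<close> in \<open>Q\<close> splits into its constant term, which comes
  from the contraction, and the remainder, which has positive degree and stays in \<open>Q\<close>
  by \<open>const\<close>.\<close>

lemma genideal_contract_irrelevant:
  assumes "ideal Q Rees" and const: "\<And>f. f \<in> Q \<Longrightarrow> up_ring.monom P (up_ring.coeff P f 0) 0 \<in> Q"
  shows "genideal Rees (in_degree R 0 (rees_contract R Q) \<union> (Q \<inter> rees_irrelevant R I)) = Q"
    (is "genideal Rees ?S = Q")
proof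
  interpret Q: ideal Q Rees by fact
  have "?S \<subseteq> Q"
    by (auto simp: in_degree_def rees_contract_def)
  then show "genideal Rees ?S \<subseteq> Q"
    using assms(1) by (rule Rees.genideal_minimal[rotated])
  have "?S \<subseteq> carrier Rees"
    using \<open>?S \<subseteq> Q\<close> Q.a_subset by blast
  then interpret G: ideal "genideal Rees ?S" Rees
    by (rule Rees.genideal_ideal)
  note gen = subsetD[OF Rees.genideal_self[OF \<open>?S \<subseteq> carrier Rees\<close>]]
  show "Q \<subseteq> genideal Rees ?S"
  proof
    fix f assume f: "f \<in> Q"
    have fP: "f \<in> carrier P"
      using f Q.Icarr Rees_closed by blast
    let ?c = "up_ring.monom P (up_ring.coeff P f 0) 0" and ?m = "up_ring.monom P (\<ominus> up_ring.coeff P f 0) 0"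
    have c: "?c \<in> Q"
      using const f .
    have "up_ring.monom P (\<ominus> \<one>) 0 \<otimes>\<^bsub>P\<^esub> ?c \<in> Q"
      using c Q.I_l_closed[of ?c "up_ring.monom P (\<ominus> \<one>) 0"] monom_Rees[of "\<ominus> \<one>" 0] by simp
    then have "?m \<in> Q"
      using fP by (simp add: P.l_minus)
    then have "f \<oplus>\<^bsub>P\<^esub> ?m \<in> Q"
      using Q.a_closed[OF f] by simp
    moreover from this have "f \<oplus>\<^bsub>P\<^esub> ?m \<in> rees_irrelevant R I"
      using Q.Icarr fP by (simp add: rees_irrelevant_def R.r_neg flip: P_def)
    ultimately have "f \<oplus>\<^bsub>P\<^esub> ?m \<in> genideal Rees ?S"
      by (intro gen) blast
    moreover have "?c \<in> genideal Rees ?S"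
      using c fP by (intro gen) (auto simp: in_degree_def rees_contract_def simp flip: P_def)
    ultimately have "(f \<oplus>\<^bsub>P\<^esub> ?m) \<oplus>\<^bsub>P\<^esub> ?c \<in> genideal Rees ?S"
      using G.a_closed by simp
    then show "f \<in> genideal Rees ?S"
      using fP by (simp add: P.a_assoc P.l_neg)
  qed
qed

section \<open>Minimal primes over the Aluffi ideal\<close>

lemma aluffi_subset_iff:
  assumes "J \<subseteq> I" "ideal Q Rees"
  shows "aluffi_ideal R I J \<subseteq> Q \<longleftrightarrow> (\<forall>a\<in>J. up_ring.monom P a 0 \<in> Q \<and> up_ring.monom P a 1 \<in> Q)"
proof -
  have "in_degree R 0 J \<union> in_degree R 1 J \<subseteq> carrier Rees"
    using assms(1) ideal.Icarr[OF I_ideal] monom_Rees[of _ 0] monom_Rees[of _ "Suc 0"]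
    by (auto simp: in_degree_def simp flip: P_def)
  then have "aluffi_ideal R I J \<subseteq> Q \<longleftrightarrow> in_degree R 0 J \<union> in_degree R 1 J \<subseteq> Q"
    unfolding aluffi_ideal_def using Rees.Idl_subset_ideal[OF assms(2)] by blast
  then show ?thesis
    by (auto simp: in_degree_def simp flip: P_def)
qed

text \<open>An element of \<open>J\<close> lies in \<open>q\<close>, in \<open>power_I 0\<close>
  and, because \<open>J \<subseteq> I\<close>, in \<open>power_I 1\<close>; so both kinds of
  generators belong to the tilde ideal.\<close>

lemma aluffi_subset_rees_tilde:
  assumes "J \<subseteq> I" "primeideal q R" "J \<subseteq> q"
  shows "aluffi_ideal R I J \<subseteq> rees_tilde R I q"
proof -
  interpret q: primeideal q R by fact
  have "ideal (rees_tilde R I q) Rees"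
    using primeideal_rees_tilde[OF assms(2)] by (rule primeideal.axioms(1))
  have tilde: "up_ring.monom P a t \<in> rees_tilde R I q" if "a \<in> q" "a \<in> power_I t" for a t
    unfolding rees_tilde_eq[OF q.is_ideal]
    using that R.i_intersect[OF q.is_ideal ideal_power_I]
    by (intro monom_graded_set ideal.axioms(1)) auto
  show ?thesis
    using assms(1,3) tilde[of _ 0] tilde[of _ 1] ideal.Icarr[OF I_ideal]
    unfolding aluffi_subset_iff[OF assms(1) \<open>ideal (rees_tilde R I q) Rees\<close>] by simp blast
qed

text \<open>For minimality of the contraction over \<open>J\<close>, a smaller prime
  \<open>q'\<close> containing \<open>J\<close> has a tilde ideal that is prime, contains the Aluffi
  ideal and lies in \<open>Q\<close>. It therefore equals \<open>Q\<close>, and contracting gives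
  back \<open>q'\<close>.\<close>

lemma minimal_prime_aluffi_eq_tilde:
  assumes J: "J \<subseteq> I"
    and min: "minimal_prime_over Rees (aluffi_ideal R I J) Q"
    and "\<not> I \<subseteq> rees_contract R Q"
  shows "minimal_prime_over R J (rees_contract R Q)" "Q = rees_tilde R I (rees_contract R Q)"
proof -
  let ?q = "rees_contract R Q"
  have Q: "primeideal Q Rees" and AQ: "aluffi_ideal R I J \<subseteq> Q"
    using min by (auto simp: minimal_prime_over_def)
  have q: "primeideal ?q R"
    using Q by (rule primeideal_rees_contract)
  have "J \<subseteq> ?q"
    using AQ J ideal.Icarr[OF I_ideal] aluffi_subset_iff[OF J primeideal.axioms(1)[OF Q]]
    by (auto simp: rees_contract_def simp flip: P_def)
  have eq: "rees_tilde R I q' = Q" if "primeideal q' R" "J \<subseteq> q'" "rees_tilde R I q' \<subseteq> Q" for q'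
    using min that primeideal_rees_tilde aluffi_subset_rees_tilde[OF J]
    by (auto simp: minimal_prime_over_def)
  show Qq: "Q = rees_tilde R I ?q"
    using eq[OF q \<open>J \<subseteq> ?q\<close>] rees_tilde_contract_subset[OF Q assms(3)] by simp
  have "q' = ?q" if q': "primeideal q' R" "J \<subseteq> q'" "q' \<subseteq> ?q" for q'
  proof -
    have ideals: "ideal q' R" "ideal ?q R"
      using q q'(1) by (auto dest: primeideal.axioms(1))
    then have "rees_tilde R I q' \<subseteq> rees_tilde R I ?q"
      using q'(3) by (auto simp: rees_tilde_eq graded_set_def)
    then have "rees_tilde R I q' = Q"
      using eq[OF q'(1,2)] Qq by simp
    then show ?thesis
      using rees_contract_tilde[OF ideals(1)] by simp
  qed
  then show "minimal_prime_over R J ?q"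
    using q \<open>J \<subseteq> ?q\<close> by (auto simp: minimal_prime_over_def)
qed

text \<open>The Aluffi ideal is generated by homogeneous elements, of degrees 0 and 1.\<close>

lemma minimal_prime_aluffi_homogeneous:
  assumes "J \<subseteq> I" "minimal_prime_over Rees (aluffi_ideal R I J) Q" "f \<in> Q"
  shows "up_ring.monom P (up_ring.coeff P f t) t \<in> Q"
proof (rule minimal_prime_homogeneous[OF _ _ assms(3)])
  show "minimal_prime_over Rees (genideal Rees (in_degree R 0 J \<union> in_degree R 1 J)) Q"
    using assms(2) by (simp add: aluffi_ideal_def)
  fix g assume "g \<in> in_degree R 0 J \<union> in_degree R 1 J"
  then obtain a t where "a \<in> J" "g = up_ring.monom P a t" "t = 0 \<or> t = 1"
    by (auto simp: in_degree_def simp flip: P_def)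
  then show "\<exists>t. \<exists>c\<in>power_I t. g = up_ring.monom P c t"
    using assms(1) ideal.Icarr[OF I_ideal] by (intro exI[of _ t] bexI[of _ a]) auto
qed

end

theorem proposition2p8:
  fixes R :: "('a, 'm) ring_scheme" and I J :: "'a set" and \<PP> :: "(nat \<Rightarrow> 'a) set"
  assumes "cring R" and "noetherian_ring R"
    and "ideal I R" and "ideal J R" and "J \<subseteq> I" and "I \<noteq> carrier R"
    and "minimal_prime_over (rees_algebra R I) (aluffi_ideal R I J) \<PP>"
  shows "(\<exists>p. minimal_prime_over R J p \<and> \<PP> = rees_tilde R I p) \<or>
    ((\<exists>p. minimal_prime_over R I p \<and> p \<subseteq> rees_contract R \<PP>) \<and>
     \<PP> = genideal (rees_algebra R I)
           (in_degree R 0 (rees_contract R \<PP>) \<union> (\<PP> \<inter> rees_irrelevant R I)))"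
proof -
  interpret rees_ring R "UP R" I
    using assms(1,3) by (intro rees_ring.intro UP_cring.intro rees_ring_axioms.intro)
  have prime: "primeideal \<PP> Rees"
    using assms(7) by (simp add: minimal_prime_over_def)
  show ?thesis
  proof (cases "I \<subseteq> rees_contract R \<PP>")
    case True
    have "genideal Rees (in_degree R 0 (rees_contract R \<PP>) \<union> (\<PP> \<inter> rees_irrelevant R I)) = \<PP>"
      using prime minimal_prime_aluffi_homogeneous[OF assms(5,7)]
      by (intro genideal_contract_irrelevant) (auto dest: primeideal.axioms(1))
    then show ?thesis
      using R.minimal_prime_below[OF primeideal_rees_contract[OF prime] True] by simp
  next
    case False
    then show ?thesis
      using minimal_prime_aluffi_eq_tilde[OF assms(5,7)] by blast
  qed
qed

end
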